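(* For all integers $n\ge 3$ and all integers $m$ with $n-1\le m\le\binom n2$, $$b_2(n,m)-b_1(n,m)<\frac{\sqrt{3n}}{4}+1 .$$
   Context: The numbers $b_1(n,m)$ and $b_2(n,m)$ are explicit lower and upper bounds for $B(n,m)$, the maximum Gromov hyperbolicity constant of simple connected graphs with $n$ vertices and $m$ unit-length edges. They are defined, for $n\ge 3$ and $n-1\le m\le\binom n2$, as follows. For integers $1\le r\le n/2$ let $M(n,1)=\frac{n(n-1)}{2}$, $M(n,2)=\frac12(n^2-n-2)$, $M(n,3)=\frac12(n^2-3n+2)$, and $M(n,r)=\frac12\left[(n-2r+3)^2+5n-19\right]$ for $r\ge 4$. (For fixed $n$, $M(n,r)$ is non-increasing in $r$.) Lower bound: $b_1(n,m)=0$ if $m=n-1$; $b_1(n,m)=n/4$ if $n\le m\le n+3$; and $b_1(n,m)=\frac{n-n_0+3}{4}$ if $m>n+3$, where $n_0$ is the unique integer with $5\le n_0\le n$ and $n+\binom{n_0-2}{2}<m\le n+\binom{n_0-1}{2}$. Upper bound: $b_2(n,m)=0$ if $m=n-1$; $b_2(n,m)=n/4$ if $n\le m\le n+3$; if $m>n+3$ and there is an integer $r$ with $2\le r\le n/2$ and $M(n,r)<m\le M(n,r-1)$, then $b_2(n,m)=r/2$; and $b_2(n,m)=n/4$ if $n+3<m\le M(n,\lfloor n/2\rfloor)$. *)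

theory Defs
  imports Complex_Main
begin

text \<open>
  Explicit lower and upper bounds \<open>b1 n m\<close> and \<open>b2 n m\<close> for the maximum Gromov hyperbolicity
  constant \<open>B(n,m)\<close> of simple connected graphs with \<open>n\<close> vertices and \<open>m\<close> edges of unit length.
  All definitions are intended for \<open>n \<ge> 3\<close> and \<open>n - 1 \<le> m \<le> n choose 2\<close> only.
\<close>

text \<open>Meaningful for \<open>1 \<le> r \<le> n / 2\<close>; the arithmetic is real, so nothing is truncated.\<close>

definition M :: "nat \<Rightarrow> nat \<Rightarrow> real" where
  "M n r =
    (if r = 1 then real n * (real n - 1) / 2
     else if r = 2 then ((real n)\<^sup>2 - real n - 2) / 2
     else if r = 3 then ((real n)\<^sup>2 - 3 * real n + 2) / 2
     else ((real n - 2 * real r + 3)\<^sup>2 + 5 * real n - 19) / 2)"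

definition is_n0 :: "nat \<Rightarrow> nat \<Rightarrow> nat \<Rightarrow> bool" where
  "is_n0 n m n0 \<longleftrightarrow>
    5 \<le> n0 \<and> n0 \<le> n \<and> n + ((n0 - 2) choose 2) < m \<and> m \<le> n + ((n0 - 1) choose 2)"

definition b1 :: "nat \<Rightarrow> nat \<Rightarrow> real" where
  "b1 n m =
    (if m = n - 1 then 0
     else if m \<le> n + 3 then real n / 4
     else (real n - real (THE n0. is_n0 n m n0) + 3) / 4)"

text \<open>At most one \<open>r\<close> qualifies, because \<open>M n r\<close> is non-increasing in \<open>r\<close> for \<open>1 \<le> r \<le> n / 2\<close>.\<close>

definition is_r :: "nat \<Rightarrow> nat \<Rightarrow> nat \<Rightarrow> bool" where
  "is_r n m r \<longleftrightarrow>
    2 \<le> r \<and> real r \<le> real n / 2 \<and> M n r < real m \<and> real m \<le> M n (r - 1)"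

text \<open>On the intended range the four cases are exhaustive, so \<open>undefined\<close> is never reached.\<close>

definition b2 :: "nat \<Rightarrow> nat \<Rightarrow> real" where
  "b2 n m =
    (if m = n - 1 then 0
     else if m \<le> n + 3 then real n / 4
     else if \<exists>r. is_r n m r then real (THE r. is_r n m r) / 2
     else if real m \<le> M n (n div 2) then real n / 4
     else undefined)"

end

theory Submission
  imports Defs
begin

text \<open>
  Write \<open>k = n\<^sub>0 - 2\<close> and \<open>t = n - 2 r\<close>. The claim amounts to \<open>k - t - 5 < \<surd>(3 n)\<close>. The inequalities
  \<open>n + k (k - 1) / 2 < m \<le> M n (r - 1)\<close> give \<open>k (k - 1) < (t + 5)\<^sup>2 + 3 n - 19\<close> when \<open>r \<ge> 5\<close>, and
  comparing squares yields the claim. For \<open>r \<le> 4\<close> it follows already from \<open>k \<le> n - 2\<close>.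
  When \<open>m > n + 3\<close> and no \<open>r\<close> exists, \<open>m \<le> M n (n div 2)\<close> and the same comparison works with \<open>t = 0\<close>.
\<close>

lemma real_choose_two: "real (n choose 2) = real n * (real n - 1) / 2"
  by (induction n) (auto simp: numeral_2_eq_2 field_simps)

text \<open>A discrete intermediate value principle, used to place \<open>m\<close> between
  neighbouring thresholds when \<open>n0\<close> and \<open>r\<close> are sought.\<close>

lemma ex_first_change:
  fixes a b :: nat
  assumes "a \<le> b" and "\<not> P a" and "P b"
  shows "\<exists>j. a < j \<and> j \<le> b \<and> \<not> P (j - 1) \<and> P j"
  using assms
proof (induction b rule: dec_induct)
  case base
  then show ?case by simp
next
  case (step b)
  show ?case
  proof (cases "P b")
    case True
    then show ?thesis using step by (meson le_SucI)
  next
    case False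
    then show ?thesis using step by (intro exI[of _ "Suc b"]) auto
  qed
qed

text \<open>From \<open>j\<close> to \<open>Suc j\<close> with \<open>j \<ge> 4\<close> only the
  square changes, and \<open>2 * j \<le> n\<close> keeps its base nonnegative; the irregular values
  at 1, 2, 3 are compared directly.\<close>

lemma M_antimono:
  assumes "1 \<le> i" and "i \<le> j" and "2 * j \<le> n"
  shows "M n j \<le> M n i"
  using assms(2,3)
proof (induction j rule: dec_induct)
  case base
  then show ?case by simp
next
  case (step j)
  have "2 * real j + 2 \<le> real n"
    using of_nat_mono[OF step.prems, where 'a = real] by simp
  moreover have "(real n - 2 * real j + 1)\<^sup>2 \<le> (real n - 2 * real j + 3)\<^sup>2"
    using calculation by (intro power_mono) auto
  moreover consider "j = 1" | "j = 2" | "j = 3" | "j \<ge> 4"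
    using assms(1) step.hyps by linarith
  ultimately have "M n (Suc j) \<le> M n j"
    by cases (simp_all add: M_def field_simps power2_eq_square)
  then show ?case using step by simp
qed

text \<open>For \<open>a < b\<close> we have \<open>a - 1 \<le> b - 2\<close>, so the range of
  \<open>m\<close> for \<open>a\<close> ends before that for \<open>b\<close> begins.\<close>

lemma the_is_n0:
  assumes "is_n0 n m k"
  shows "(THE k. is_n0 n m k) = k"
proof (rule the_equality[where P = "is_n0 n m", OF assms])
  fix j assume j: "is_n0 n m j"
  have "\<not> a < b" if "is_n0 n m a" "is_n0 n m b" for a b
  proof
    assume "a < b"
    then have "(a - 1) choose 2 \<le> (b - 2) choose 2"
      by (intro binomial_right_mono) auto
    then show False using that by (auto simp: is_n0_def)
  qed
  then show "j = k" using j assms by (meson linorder_neqE_nat)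
qed

lemma the_is_r:
  assumes "is_r n m r"
  shows "(THE r. is_r n m r) = r"
proof (rule the_equality[where P = "is_r n m", OF assms])
  fix j assume j: "is_r n m j"
  have "\<not> a < b" if "is_r n m a" "is_r n m b" for a b
  proof
    assume "a < b"
    then have "M n (b - 1) \<le> M n a"
      using that by (intro M_antimono) (auto simp: is_r_def)
    then show False using that by (auto simp: is_r_def)
  qed
  then show "j = r" using j assms by (meson linorder_neqE_nat)
qed

lemma ex_is_n0:
  assumes "n + 3 < m" and "m \<le> n choose 2"
  shows "\<exists>k. is_n0 n m k"
proof -
  have n: "5 \<le> n"
  proof (rule ccontr)
    assume "\<not> 5 \<le> n"
    then have "real n * (real n - 1) \<le> real n * 3"
      by (intro mult_left_mono) auto
    moreover have "real n + 3 < real (n choose 2)"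
      using assms by linarith
    ultimately show False
      using \<open>\<not> 5 \<le> n\<close> by (simp add: real_choose_two)
  qed
  have "real (n choose 2) \<le> real (n + ((n - 1) choose 2))"
    using n by (simp add: real_choose_two of_nat_diff field_simps)
  then have "m \<le> n + ((n - 1) choose 2)"
    using assms(2) by linarith
  \<comment> \<open>The search starts at 4, where the threshold is
    \<open>n + (3 choose 2) = n + 3\<close>, which is below \<open>m\<close>; hence
    \<open>k \<ge> 5\<close>.\<close>
  then obtain k where "4 < k" "k \<le> n" "n + ((k - 1 - 1) choose 2) < m" "m \<le> n + ((k - 1) choose 2)"
    using ex_first_change[of 4 n "\<lambda>k. m \<le> n + ((k - 1) choose 2)"] n assms(1)
    by (auto simp: choose_two not_le)
  moreover have "k - 1 - 1 = k - 2" by simp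
  ultimately have "is_n0 n m k"
    by (simp add: is_n0_def)
  then show ?thesis by blast
qed

text \<open>The thresholds start at \<open>M n 1 = n choose 2\<close>, which is at least
  \<open>m\<close>, and end below \<open>m\<close> at \<open>n div 2\<close>.\<close>

lemma ex_is_r:
  assumes "2 \<le> n" and "m \<le> n choose 2" and "M n (n div 2) < real m"
  shows "\<exists>r. is_r n m r"
proof -
  have "real m \<le> M n 1"
    using assms(2) real_choose_two[of n] by (simp add: M_def)
  then obtain r where "1 < r" "r \<le> n div 2" "real m \<le> M n (r - 1)" "M n r < real m"
    using ex_first_change[of 1 "n div 2" "\<lambda>r. M n r < real m"] assms by (fastforce simp: not_less)
  then have "is_r n m r"
    by (auto simp: is_r_def)
  then show ?thesis by blast
qed

text \<open>If \<open>k \<ge> t + 5 + s\<close>, then \<open>k * (k - 1)\<close> exceeds the assumed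
  bound by at least \<open>2 * t * s - t + 9 * s + 14\<close>, which is positive.\<close>

lemma less_of_product_bound:
  fixes k t s :: real
  assumes "k * (k - 1) < (t + 5)\<^sup>2 + s\<^sup>2 - 19" and "0 \<le> t" and "1 \<le> s"
  shows "k < t + 5 + s"
proof (rule ccontr)
  assume "\<not> k < t + 5 + s"
  then have "(t + 5 + s) * (t + 4 + s) \<le> k * (k - 1)"
    using assms by (intro mult_mono) auto
  moreover have "0 \<le> t * (s - 1)"
    using assms by simp
  ultimately show False
    using assms by (simp add: power2_eq_square algebra_simps)
qed

lemma is_n0_bounds:
  assumes "is_n0 n m k"
  shows "(real k - 2) * (real k - 3) < 2 * real m - 2 * real n" and "real k \<le> real n"
proof -
  have "real (n + ((k - 2) choose 2)) < real m" "5 \<le> k"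
    using assms unfolding is_n0_def of_nat_less_iff by auto
  then show "(real k - 2) * (real k - 3) < 2 * real m - 2 * real n"
    by (simp add: real_choose_two of_nat_diff field_simps)
  show "real k \<le> real n"
    using assms by (simp add: is_n0_def)
qed

theorem theorem4p5:
  fixes n m :: nat
  assumes "n \<ge> 3" and "n - 1 \<le> m" and "m \<le> n choose 2"
  shows "b2 n m - b1 n m < sqrt (3 * real n) / 4 + 1"
proof (cases "m \<le> n + 3")
  case True
  then show ?thesis
    by (simp add: b1_def b2_def add_nonneg_pos)
next
  case False
  define s where "s = sqrt (3 * real n)"
  have "sqrt (3\<^sup>2) \<le> s"
    unfolding s_def using assms(1) by (intro real_sqrt_le_mono) simp
  then have s: "s\<^sup>2 = 3 * real n" "3 \<le> s"
    by (simp_all add: s_def)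
  \<comment> \<open>Here \<open>k\<close> is \<open>n0\<close> itself, so \<open>real k - 2\<close>
    plays the part of \<open>k\<close> in the overview.\<close>
  obtain k where k: "is_n0 n m k"
    using ex_is_n0[of n m] False assms(3) by auto
  note bounds = is_n0_bounds[OF k]
  have b1: "b1 n m = (real n - real k + 3) / 4"
    using False the_is_n0[OF k] by (auto simp: b1_def)
  show ?thesis
  proof (cases "\<exists>r. is_r n m r")
    case True
    then obtain r where r: "is_r n m r" by blast
    then have b2: "b2 n m = real r / 2"
      using False the_is_r[OF r] by (auto simp: b2_def)
    have "real k - 2 < (real n - 2 * real r) + 5 + s"
    proof (cases "r \<le> 4")
      case True
      then show ?thesis using bounds(2) s(2) by simp
    next
      case False
      \<comment> \<open>With \<open>q \<ge> 4\<close> the value \<open>M n (r - 1)\<close> is given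
        by the general formula, whose base is \<open>n - 2 * q + 3 = n - 2 * r + 5\<close>.\<close>
      then obtain q where "r = Suc q" "4 \<le> q"
        by (cases r) auto
      then have "2 * real m \<le> (real n - 2 * real r + 5)\<^sup>2 + 5 * real n - 19"
        using r by (simp add: is_r_def M_def algebra_simps)
      then show ?thesis
        using bounds(1) s r
        by (intro less_of_product_bound) (auto simp: is_r_def algebra_simps)
    qed
    then show ?thesis
      unfolding b1 b2 s_def[symmetric] by (simp add: field_simps)
  next
    case no_r: False
    then have m: "real m \<le> M n (n div 2)"
      using ex_is_r[of n m] assms by (auto simp: not_less[symmetric])
    have b2: "b2 n m = real n / 4"
      using False no_r m by (auto simp: b2_def)
    \<comment> \<open>The value \<open>n / 4\<close> is \<open>r / 2\<close> at
      \<open>r = n / 2\<close>, hence \<open>t = 0\<close>.\<close>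
    have "real k - 2 < 0 + 5 + s"
    proof (cases "n div 2 < 4")
      case True
      then show ?thesis using bounds(2) s(2) by simp
    next
      case R: False
      have "real n - 2 * real (n div 2) = real (n mod 2)"
        by (simp add: minus_mult_div_eq_mod[symmetric] of_nat_diff)
      \<comment> \<open>The remainder modulo 2 is at most 1, so the base is at most
        \<open>1 + 3\<close>.\<close>
      then have "(real n - 2 * real (n div 2) + 3)\<^sup>2 \<le> 4\<^sup>2"
        by (intro power_mono) auto
      then have "2 * real m \<le> 5 * real n - 3"
        using m R by (simp add: M_def split: if_splits)
      then show ?thesis
        using bounds(1) s
        by (intro less_of_product_bound) (auto simp: algebra_simps)
    qed
    then show ?thesis
      unfolding b1 b2 s_def[symmetric] by (simp add: field_simps)
  qed
qed

end
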